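(* There exists no Pythagorean box having a pair of opposite (congruent) faces which are squares and such that, in another pair of opposite faces, the four face diagonals (which all have equal length) also have integral length.
   Context: A Pythagorean box is a rectangular parallelepiped whose edges have (positive) integer lengths $x, y, z$ and whose inner (space) diagonals also have integer length $t$; thus $x,y,z,t$ are positive integers satisfying $t^2 = x^2+y^2+z^2$. Such a box has three pairs of opposite congruent rectangular faces; the two faces with sides of lengths $x$ and $y$ have diagonals of length $\sqrt{x^2+y^2}$, and similarly for the other two pairs. *)

theory Defs
  imports Complex_Main
begin

text \<open>\<open>x, y, z\<close> are the edge lengths and \<open>t\<close> is the length of the space diagonals.\<close>

definition pythagorean_box :: "nat \<Rightarrow> nat \<Rightarrow> nat \<Rightarrow> nat \<Rightarrow> bool" where
  "pythagorean_box x y z t \<longleftrightarrow>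
     x > 0 \<and> y > 0 \<and> z > 0 \<and> t > 0 \<and> t^2 = x^2 + y^2 + z^2"

text \<open>The three pairs of opposite faces, named by the edges spanning them. Pairs are
  distinguished by position and not by side lengths, so a cube also has three of them.\<close>

datatype face_pair = XY | XZ | YZ

fun face_sides :: "nat \<Rightarrow> nat \<Rightarrow> nat \<Rightarrow> face_pair \<Rightarrow> nat \<times> nat" where
  "face_sides x y z XY = (x, y)"
| "face_sides x y z XZ = (x, z)"
| "face_sides x y z YZ = (y, z)"

definition square_faces :: "nat \<Rightarrow> nat \<Rightarrow> nat \<Rightarrow> face_pair \<Rightarrow> bool" where
  "square_faces x y z F \<longleftrightarrow> (case face_sides x y z F of (a, b) \<Rightarrow> a = b)"

definition face_diagonal :: "nat \<Rightarrow> nat \<Rightarrow> nat \<Rightarrow> face_pair \<Rightarrow> real" where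
  "face_diagonal x y z F =
     (case face_sides x y z F of (a, b) \<Rightarrow> sqrt ((real a)^2 + (real b)^2))"

end

theory Submission
  imports Defs "HOL-Computational_Algebra.Nth_Powers"
begin

text \<open>If the square face has side \<open>a\<close>, the third edge is \<open>b\<close>, and the integral face diagonal is
  \<open>d\<close>, then \<open>b\<^sup>2\<close>, \<open>d\<^sup>2\<close>, \<open>t\<^sup>2\<close> is an arithmetic progression of squares with the square
  difference \<open>a\<^sup>2\<close>, which Fermat's infinite descent on \<open>d\<close> excludes: for coprime \<open>a, d\<close> the numbers
  \<open>m = (t + b) / 2\<close> and \<open>n = (t - b) / 2\<close> are the legs of a primitive right triangle with hypotenuse
  \<open>d\<close> and \<open>2 m n = a\<^sup>2\<close>. Parametrising the triangle by \<open>p, q\<close>, the pairwise coprime numbers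
  \<open>p, q, p + q, p - q\<close> have a square product, hence are squares and form a smaller such
  progression \<open>p - q, p, p + q\<close> with square difference \<open>q\<close>.\<close>

lemma coprime_mult_square_nat:
  fixes a b c :: nat
  assumes "coprime a b" "a * b = c\<^sup>2"
  obtains u v where "a = u\<^sup>2" "b = v\<^sup>2"
proof -
  have "is_nth_power 2 (a * b)"
    unfolding assms(2) by simp
  then have "is_nth_power 2 a \<and> is_nth_power 2 b"
    using is_nth_power_mult_coprime_nat_iff[OF assms(1)] by simp
  then show thesis
    using that by (auto simp: is_nth_power_def)
qed

text \<open>The factors \<open>(d + m) / 2\<close> and \<open>(d - m) / 2\<close> are coprime with
  product \<open>(n / 2)^2\<close>, so each is a square, of \<open>p\<close> and \<open>q\<close>
  respectively. Writing \<open>p^2 = m + q^2\<close> avoids truncated subtraction.\<close>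

lemma primitive_pythagorean_triple:
  fixes m n d :: nat
  assumes triple: "m\<^sup>2 + n\<^sup>2 = d\<^sup>2" and "coprime m n" "even n"
  obtains p q where "p\<^sup>2 = m + q\<^sup>2" "n = 2 * p * q" "d = p\<^sup>2 + q\<^sup>2" "coprime p q"
proof -
  obtain k where n: "n = 2 * k"
    using \<open>even n\<close> by blast
  have "odd m"
    using \<open>coprime m n\<close> \<open>even n\<close> coprime_common_divisor by fastforce
  have "odd (d\<^sup>2)"
    using \<open>odd m\<close> \<open>even n\<close> by (simp flip: triple)
  then have "odd d"
    by simp
  have "m\<^sup>2 \<le> d\<^sup>2"
    by (simp flip: triple)
  then have "m \<le> d"
    by simp
  \<comment> \<open>The division is exact because \<open>d\<close> and \<open>m\<close> are both
    odd; \<open>m + v\<close> is then half of \<open>d + m\<close>.\<close>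
  define v where "v = (d - m) div 2"
  have d: "d = m + 2 * v"
    using \<open>m \<le> d\<close> \<open>odd m\<close> \<open>odd d\<close> by (simp add: v_def)
  have prod: "(m + v) * v = k\<^sup>2"
    using triple unfolding n d by (simp add: power2_eq_square algebra_simps)
  have "coprime (m + v) v"
  proof (rule coprimeI)
    fix c assume c: "c dvd m + v" "c dvd v"
    then have "c dvd m"
      by (simp add: dvd_add_left_iff)
    have "c * c dvd k\<^sup>2"
      using c by (simp flip: prod add: mult_dvd_mono)
    then have "c dvd k"
      by (simp flip: power2_eq_square)
    then have "c dvd n"
      by (simp add: n)
    with \<open>c dvd m\<close> show "is_unit c"
      using \<open>coprime m n\<close> coprime_common_divisor by blast
  qed
  from coprime_mult_square_nat[OF this prod] obtain p q where pq: "m + v = p\<^sup>2" "v = q\<^sup>2" .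
  show thesis
  proof
    show "p\<^sup>2 = m + q\<^sup>2" "d = p\<^sup>2 + q\<^sup>2"
      using pq d by auto
    have "(p * q)\<^sup>2 = k\<^sup>2"
      using prod by (simp add: pq power_mult_distrib flip: pq(1))
    then have "p * q = k"
      by simp
    then show "n = 2 * p * q"
      by (simp add: n)
    show "coprime p q"
      using \<open>coprime (m + v) v\<close> unfolding pq(1) by (simp add: pq(2))
  qed
qed

text \<open>One descent step, with \<open>d'^2 = p\<close>, \<open>a'^2 = q\<close>,
  \<open>b'^2 = p - q\<close> and \<open>t'^2 = p + q\<close>.\<close>

lemma square_progression_descent:
  fixes a m n d :: nat
  assumes "m\<^sup>2 + n\<^sup>2 = d\<^sup>2" "2 * m * n = a\<^sup>2" "coprime m n" "even n" "m > 0" "n > 0"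
  obtains a' b' d' t' where "a' > 0" "b' > 0" "d' < d"
    "d'\<^sup>2 + a'\<^sup>2 = t'\<^sup>2" "a'\<^sup>2 + b'\<^sup>2 = d'\<^sup>2"
proof -
  obtain p q where pq: "p\<^sup>2 = m + q\<^sup>2" "n = 2 * p * q" "d = p\<^sup>2 + q\<^sup>2" "coprime p q"
    using primitive_pythagorean_triple assms by metis
  have "p > 0" "q > 0"
    using pq(2) \<open>n > 0\<close> by auto
  have "odd m"
    using \<open>coprime m n\<close> \<open>even n\<close> coprime_common_divisor by fastforce
  have "q\<^sup>2 < p\<^sup>2"
    using pq(1) \<open>m > 0\<close> by simp
  then have "q < p"
    by (rule power_less_imp_less_base) simp
  \<comment> \<open>\<open>r\<close> stands for \<open>p - q\<close>, so that
    \<open>m = p^2 - q^2\<close> factors without subtraction on \<open>nat\<close>.\<close>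
  then obtain r where p: "p = q + r" and "r > 0"
    using less_imp_add_positive by metis
  have m: "m = (p + q) * r"
    using pq(1) by (simp add: p power2_eq_square algebra_simps)
  have "odd (p + q)" "odd r"
    using \<open>odd m\<close> by (auto simp: m)
  have "coprime r q"
    using \<open>coprime p q\<close> by (simp add: p coprime_iff_gcd_eq_1 gcd.commute)
  have "coprime p r"
    using \<open>coprime r q\<close> by (metis coprime_iff_gcd_eq_1 gcd.commute gcd_add1 p)
  have "coprime (p + q) r"
  proof -
    \<comment> \<open>Modulo \<open>r\<close> the sum \<open>p + q\<close> is \<open>2 * q\<close>,
      and the factor 2 is harmless because \<open>r\<close> is odd.\<close>
    have "coprime (2 * q) r"
      using \<open>coprime r q\<close> \<open>odd r\<close> by (simp add: coprime_commute)
    moreover have "p + q = 2 * q + r"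
      by (simp add: p)
    ultimately show ?thesis
      by (metis coprime_iff_gcd_eq_1 gcd.commute gcd_add2 add.commute)
  qed
  have "even a"
    using assms(2) by (metis dvd_triv_left even_power mult.assoc)
  then obtain c where a: "a = 2 * c"
    by blast
  \<comment> \<open>After substitution \<open>2 * m * n\<close> is
    \<open>4 * p * q * (p + q) * r\<close>, and the 4 cancels against
    \<open>a^2 = 4 * c^2\<close>.\<close>
  have c: "p * (q * ((p + q) * r)) = c\<^sup>2"
    using assms(2) by (simp add: a pq(2) m power2_eq_square algebra_simps)
  have "coprime p (p + q)" "coprime q (p + q)"
    using \<open>coprime p q\<close> by (metis coprime_iff_gcd_eq_1 gcd.commute gcd_add2 add.commute)+
  then have "coprime p (q * ((p + q) * r))"
    using \<open>coprime p q\<close> \<open>coprime p r\<close> by simp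
  then obtain d' s where d': "p = d'\<^sup>2" and s: "q * ((p + q) * r) = s\<^sup>2"
    using coprime_mult_square_nat c by metis
  have "coprime q ((p + q) * r)"
    using \<open>coprime q (p + q)\<close> \<open>coprime r q\<close> by (simp add: coprime_commute)
  then obtain a' s' where a': "q = a'\<^sup>2" and s': "(p + q) * r = s'\<^sup>2"
    using coprime_mult_square_nat s by metis
  obtain t' b' where t': "p + q = t'\<^sup>2" and b': "r = b'\<^sup>2"
    using coprime_mult_square_nat \<open>coprime (p + q) r\<close> s' by metis
  have "d' \<le> p"
    by (simp add: d' power2_nat_le_imp_le)
  also have "p \<le> p\<^sup>2"
    by (simp add: power2_nat_le_imp_le)
  also have "\<dots> < d"
    using \<open>q > 0\<close> by (simp add: pq(3))
  finally have "d' < d" .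
  show thesis
  proof
    show "a' > 0" "b' > 0"
      using \<open>q > 0\<close> \<open>r > 0\<close> a' b' by auto
    show "d'\<^sup>2 + a'\<^sup>2 = t'\<^sup>2" "a'\<^sup>2 + b'\<^sup>2 = d'\<^sup>2"
      using d' a' t' b' p by metis+
  qed fact
qed

text \<open>A common factor of \<open>a\<close> and \<open>d\<close> also divides \<open>b\<close>
  and \<open>t\<close>, so dividing it out already gives a smaller instance; in the coprime case
  \<open>square_progression_descent\<close> supplies one.\<close>

theorem no_square_progression_with_square_difference:
  fixes a b d t :: nat
  assumes "a > 0" "b > 0" "d\<^sup>2 + a\<^sup>2 = t\<^sup>2" "a\<^sup>2 + b\<^sup>2 = d\<^sup>2"
  shows False
  using assms
proof (induction d arbitrary: a b t rule: less_induct)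
  case (less d)
  define g where "g = gcd a d"
  have "g > 0"
    using less.prems by (simp add: g_def)
  obtain a' d' where a': "a = g * a'" and d': "d = g * d'"
    unfolding g_def by (meson dvdE gcd_dvd1 gcd_dvd2)
  have "d > 0"
    using less.prems by (cases d) auto
  show False
  proof (cases "g = 1")
    case False
    have t: "t\<^sup>2 = g\<^sup>2 * (d'\<^sup>2 + a'\<^sup>2)"
      using less.prems(3) by (simp add: a' d' power_mult_distrib algebra_simps)
    have b: "b\<^sup>2 + g\<^sup>2 * a'\<^sup>2 = g\<^sup>2 * d'\<^sup>2"
      using less.prems(4) by (simp add: a' d' power_mult_distrib algebra_simps)
    have "g\<^sup>2 dvd t\<^sup>2"
      by (simp add: t)
    then obtain t' where t': "t = g * t'"
      by auto
    have "g\<^sup>2 dvd b\<^sup>2"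
      using b by (metis dvd_add_left_iff dvd_triv_left)
    then obtain b' where b': "b = g * b'"
      by auto
    have "g\<^sup>2 * (a'\<^sup>2 + b'\<^sup>2) = g\<^sup>2 * d'\<^sup>2"
      using b by (simp add: b' power_mult_distrib algebra_simps)
    then have "a'\<^sup>2 + b'\<^sup>2 = d'\<^sup>2"
      using \<open>g > 0\<close> by simp
    moreover have "g\<^sup>2 * (d'\<^sup>2 + a'\<^sup>2) = g\<^sup>2 * t'\<^sup>2"
      using t by (simp only: t' power_mult_distrib)
    then have "d'\<^sup>2 + a'\<^sup>2 = t'\<^sup>2"
      using \<open>g > 0\<close> by simp
    moreover have "d' < d"
      using False \<open>g > 0\<close> \<open>d > 0\<close> by (simp add: d')
    moreover have "a' > 0" "b' > 0"
      using less.prems by (auto simp: a' b')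
    ultimately show False
      using less.IH by blast
  next
    case True
    then have "coprime a d"
      by (simp add: g_def coprime_iff_gcd_eq_1)
    have sum: "t\<^sup>2 = b\<^sup>2 + 2 * a\<^sup>2"
      using less.prems by simp
    then have "even (t\<^sup>2) \<longleftrightarrow> even (b\<^sup>2)"
      by simp
    then have "even t \<longleftrightarrow> even b"
      by simp
    have "b\<^sup>2 < t\<^sup>2"
      using sum \<open>a > 0\<close> by simp
    then have "b < t"
      by (rule power_less_imp_less_base) simp
    \<comment> \<open>By equal parity \<open>n\<close> and \<open>m\<close> are exactly the halves
      of \<open>t - b\<close> and \<open>t + b\<close>. Hence
      \<open>4 * m * n = t^2 - b^2 = 2 * a^2\<close>, and \<open>m^2 + n^2\<close> is the mean
      \<open>d^2\<close> of \<open>t^2\<close> and \<open>b^2\<close>.\<close>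
    define n where "n = (t - b) div 2"
    define m where "m = b + n"
    have t: "t = b + 2 * n"
      using \<open>b < t\<close> \<open>even t \<longleftrightarrow> even b\<close> by (simp add: n_def)
    have "n > 0" "m > 0"
      using t \<open>b < t\<close> by (auto simp: m_def)
    have mn: "2 * m * n = a\<^sup>2"
      using sum by (simp add: t m_def power2_eq_square algebra_simps)
    have hyp: "m\<^sup>2 + n\<^sup>2 = d\<^sup>2"
      using less.prems(4) mn by (simp add: m_def power2_eq_square algebra_simps)
    have "coprime m n"
    proof (rule coprimeI)
      fix c assume c: "c dvd m" "c dvd n"
      have "c\<^sup>2 dvd d\<^sup>2"
        using c by (simp flip: hyp)
      moreover have "c * c dvd 2 * (m * n)"
        using c by (intro dvd_mult mult_dvd_mono)
      then have "c\<^sup>2 dvd a\<^sup>2"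
        by (simp only: mn[symmetric] power2_eq_square[of c] mult.assoc)
      ultimately have "c dvd a" "c dvd d"
        by simp_all
      then show "is_unit c"
        using \<open>coprime a d\<close> coprime_common_divisor by blast
    qed
    have "even (a\<^sup>2)"
      by (simp flip: mn)
    then have "even a"
      by simp
    then obtain k where "a = 2 * k"
      by blast
    then have "m * n = 2 * k\<^sup>2"
      using mn by (simp add: power2_eq_square)
    \<comment> \<open>The descent step is symmetric in \<open>m\<close> and \<open>n\<close> except
      that the second leg must be even, so they are swapped if necessary.\<close>
    then have "even m \<or> even n"
      by (metis dvd_triv_left even_mult_iff)
    then obtain a' b' d' t' where "a' > 0" "b' > 0" "d' < d"
      "d'\<^sup>2 + a'\<^sup>2 = t'\<^sup>2" "a'\<^sup>2 + b'\<^sup>2 = d'\<^sup>2"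
    proof
      assume "even n"
      with hyp mn \<open>coprime m n\<close> \<open>m > 0\<close> \<open>n > 0\<close> show thesis
        using square_progression_descent that by blast
    next
      assume "even m"
      moreover have "n\<^sup>2 + m\<^sup>2 = d\<^sup>2" "2 * n * m = a\<^sup>2" "coprime n m"
        using hyp mn \<open>coprime m n\<close> by (simp_all add: ac_simps)
      ultimately show thesis
        using square_progression_descent that \<open>m > 0\<close> \<open>n > 0\<close> by blast
    qed
    then show False
      using less.IH by blast
  qed
qed

text \<open>The root is nonnegative, so being an integer it is a natural number and can be squared
  back into \<open>nat\<close>.\<close>

lemma sqrt_sum_squares_in_Ints:
  fixes a b :: nat
  assumes "sqrt ((real a)\<^sup>2 + (real b)\<^sup>2) \<in> \<int>"
  obtains d :: nat where "a\<^sup>2 + b\<^sup>2 = d\<^sup>2"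
proof -
  have "sqrt ((real a)\<^sup>2 + (real b)\<^sup>2) \<in> \<nat>"
    using assms by (simp add: Nats_altdef2)
  then obtain d where "sqrt ((real a)\<^sup>2 + (real b)\<^sup>2) = real d"
    by (auto elim: Nats_cases)
  then have "(real a)\<^sup>2 + (real b)\<^sup>2 = (real d)\<^sup>2"
    by (metis add_nonneg_nonneg real_sqrt_pow2 zero_le_power2)
  then have "real (a\<^sup>2 + b\<^sup>2) = real (d\<^sup>2)"
    by simp
  then have "a\<^sup>2 + b\<^sup>2 = d\<^sup>2"
    by (simp only: of_nat_eq_iff)
  then show thesis
    by (rule that)
qed

theorem theorem2:
  shows "\<not> (\<exists>(x::nat) (y::nat) (z::nat) (t::nat) F G.
           pythagorean_box x y z t \<and> F \<noteq> G \<and>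
           square_faces x y z F \<and> face_diagonal x y z G \<in> \<int>)"
proof
  assume "\<exists>(x::nat) (y::nat) (z::nat) (t::nat) F G.
           pythagorean_box x y z t \<and> F \<noteq> G \<and>
           square_faces x y z F \<and> face_diagonal x y z G \<in> \<int>"
  then obtain x y z t F G where box: "pythagorean_box x y z t"
    and faces: "F \<noteq> G" "square_faces x y z F" "face_diagonal x y z G \<in> \<int>"
    by blast
  \<comment> \<open>\<open>a\<close> is the side of the square faces and \<open>b\<close> the
    remaining edge. Every face pair other than \<open>F\<close> has sides \<open>a\<close> and
    \<open>b\<close>, so both choices of \<open>G\<close> give the same diagonal.\<close>
  obtain a b where ab: "a > 0" "b > 0" "t\<^sup>2 = a\<^sup>2 + a\<^sup>2 + b\<^sup>2"
    and diagonal: "sqrt ((real a)\<^sup>2 + (real b)\<^sup>2) \<in> \<int>"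
  proof -
    have "\<exists>a b. a > 0 \<and> b > 0 \<and> t\<^sup>2 = a\<^sup>2 + a\<^sup>2 + b\<^sup>2 \<and> sqrt ((real a)\<^sup>2 + (real b)\<^sup>2) \<in> \<int>"
    proof (cases F)
      case XY
      then show ?thesis
        using box faces by (intro exI[of _ x] exI[of _ z], cases G)
          (auto simp: pythagorean_box_def square_faces_def face_diagonal_def)
    next
      case XZ
      then show ?thesis
        using box faces by (intro exI[of _ x] exI[of _ y], cases G)
          (auto simp: pythagorean_box_def square_faces_def face_diagonal_def add.commute)
    next
      case YZ
      then show ?thesis
        using box faces by (intro exI[of _ y] exI[of _ x], cases G)
          (auto simp: pythagorean_box_def square_faces_def face_diagonal_def add.commute)
    qed
    then show thesis
      using that by blast
  qed
  obtain d where "a\<^sup>2 + b\<^sup>2 = d\<^sup>2"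
    using sqrt_sum_squares_in_Ints[OF diagonal] .
  moreover from this have "d\<^sup>2 + a\<^sup>2 = t\<^sup>2"
    using ab(3) by simp
  ultimately show False
    using no_square_progression_with_square_difference ab by blast
qed

end
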